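(* Let $N\ge2$ and let $(S_i)_{i\in\mathbb{Z}_N}$ be a purely atomic representation of the Cuntz algebra $\mathcal{O}_N$ on a Hilbert space $\mathcal{H}$ with associated projection valued measure $P$. Suppose $M$ is a non-zero finite dimensional subspace of $\mathcal{H}$ which is invariant for all the maps $S_i^*$, $i\in\mathbb{Z}_N$. Then there exists a cyclic word $\omega\in\mathcal{K}_N$ and a vector $v\neq0$ in $P(\omega)\mathcal{H}\cap M$. Moreover, if $\operatorname{Per}$ is the set of periodic points in the support of $P$, then $$M\subset P(\operatorname{Per})\mathcal{H}.$$
   Context: $\mathbb{Z}_N=\{0,1,\dots,N-1\}$. A representation of the Cuntz algebra $\mathcal{O}_N$ on a Hilbert space $\mathcal{H}$ is a family $(S_i)_{i\in\mathbb{Z}_N}$ of bounded operators on $\mathcal{H}$ with $S_i^*S_j=\delta_{ij}I$ for all $i,j$ and $\sum_{i\in\mathbb{Z}_N}S_iS_i^*=I$. For a finite word $I=i_1\dots i_n$, $S_I:=S_{i_1}\cdots S_{i_n}$. $\mathcal{K}_N=\mathbb{Z}_N^{\mathbb{N}}$ is the space of infinite words with the product topology and $\sigma(\omega_1\omega_2\dots)=\omega_2\omega_3\dots$ is the shift. The projection valued measure $P$ associated to the representation is the unique projection valued measure on the Borel sets of $\mathcal{K}_N$ with $P(\{\omega:\omega_1=i_1,\dots,\omega_k=i_k\})=S_IS_I^*$ for every finite word $I=i_1\dots i_k$. Write $P(\omega)=P(\{\omega\})$. The representation is purely atomic if there is $\Omega\subset\mathcal{K}_N$ with $\oplus_{\omega\in\Omega}P(\omega)=I$;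 in that case the support of $P$ is $\{\omega\in\mathcal{K}_N:P(\omega)\neq0\}$. A word $\omega\in\mathcal{K}_N$ is periodic if $\sigma^k(\omega)=\sigma^{k'}(\omega)$ for some non-negative integers $k\neq k'$; it is cyclic if $\sigma^p(\omega)=\omega$ for some $p>0$. *)

theory Defs
  imports "HOL-Analysis.Analysis"
begin

section \<open>Complex Hilbert spaces\<close>

text \<open>The inner product is conjugate linear in the first argument and linear in the second. A
complex inner product space is also a real normed space, with compatible real scaling and norm, so
that the topology, completeness and summation of the library apply.\<close>

class complex_inner = real_normed_vector +
  fixes scaleC :: "complex \<Rightarrow> 'a \<Rightarrow> 'a"  (infixr \<open>*\<^sub>C\<close> 75)
    and cinner :: "'a \<Rightarrow> 'a \<Rightarrow> complex"
  assumes scaleC_add_right: "a *\<^sub>C (x + y) = a *\<^sub>C x + a *\<^sub>C y"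
    and scaleC_add_left: "(a + b) *\<^sub>C x = a *\<^sub>C x + b *\<^sub>C x"
    and scaleC_scaleC: "a *\<^sub>C b *\<^sub>C x = (a * b) *\<^sub>C x"
    and scaleC_one: "1 *\<^sub>C x = x"
    and scaleR_scaleC: "r *\<^sub>R x = complex_of_real r *\<^sub>C x"
    and cinner_commute: "cinner x y = cnj (cinner y x)"
    and cinner_add_right: "cinner x (y + z) = cinner x y + cinner x z"
    and cinner_scaleC_right: "cinner x (a *\<^sub>C y) = a * cinner x y"
    and cinner_ge_zero: "0 \<le> Re (cinner x x)"
    and cinner_eq_zero_iff: "cinner x x = 0 \<longleftrightarrow> x = 0"
    and norm_eq_sqrt_cinner: "norm x = sqrt (Re (cinner x x))"

class chilbert_space = complex_inner + complete_space

instantiation complex :: chilbert_space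
begin

definition scaleC_complex :: "complex \<Rightarrow> complex \<Rightarrow> complex"
  where "scaleC_complex a x = a * x"

definition cinner_complex :: "complex \<Rightarrow> complex \<Rightarrow> complex"
  where "cinner_complex x y = cnj x * y"

instance
  by standard
    (auto simp: scaleC_complex_def cinner_complex_def algebra_simps scaleR_conv_of_real
      cmod_def power2_eq_square)

end

global_interpretation complex_vector:
  vector_space "scaleC :: complex \<Rightarrow> 'a \<Rightarrow> 'a::complex_inner"
  defines csubspace = complex_vector.subspace
    and cspan = complex_vector.span
  by standard (rule scaleC_add_right scaleC_add_left scaleC_scaleC scaleC_one)+

definition bounded_clinear :: "('a::complex_inner \<Rightarrow> 'a) \<Rightarrow> bool" where
  "bounded_clinear T \<longleftrightarrow> bounded_linear T \<and> (\<forall>c x. T (c *\<^sub>C x) = c *\<^sub>C T x)"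

text \<open>As for the library's \<open>adjoint\<close> on real inner product spaces, the adjoint is chosen by its
defining property; for a bounded operator on a Hilbert space it exists and is unique.\<close>

definition cadjoint :: "('a::complex_inner \<Rightarrow> 'a) \<Rightarrow> 'a \<Rightarrow> 'a" where
  "cadjoint T = (SOME T'. \<forall>x y. cinner (T x) y = cinner x (T' y))"

definition orth_projection :: "('a::complex_inner \<Rightarrow> 'a) \<Rightarrow> bool" where
  "orth_projection Q \<longleftrightarrow> bounded_clinear Q \<and> Q \<circ> Q = Q \<and> cadjoint Q = Q"


section \<open>Infinite words\<close>

text \<open>The letter \<open>\<omega>\<^sub>k\<close> of an infinite word is \<open>\<omega> (k - 1)\<close>.\<close>

definition words :: "nat \<Rightarrow> (nat \<Rightarrow> nat) set" where
  "words N = {\<omega>. \<forall>k. \<omega> k < N}"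

text \<open>The library topology on \<^typ>\<open>nat\<close> is discrete and the one on \<^typ>\<open>nat \<Rightarrow> nat\<close> is the
product topology, so the subspace topology of \<^term>\<open>words N\<close> is the product topology of
the discrete topologies on the alphabet.\<close>

definition borel_words :: "nat \<Rightarrow> (nat \<Rightarrow> nat) set set" where
  "borel_words N = sets (restrict_space borel (words N))"

definition cylinder :: "nat \<Rightarrow> nat list \<Rightarrow> (nat \<Rightarrow> nat) set" where
  "cylinder N I = {\<omega> \<in> words N. \<forall>j<length I. \<omega> j = I ! j}"

definition shift :: "(nat \<Rightarrow> nat) \<Rightarrow> nat \<Rightarrow> nat" where
  "shift \<omega> = (\<lambda>k. \<omega> (Suc k))"

definition periodic_word :: "(nat \<Rightarrow> nat) \<Rightarrow> bool" where
  "periodic_word \<omega> \<longleftrightarrow> (\<exists>k k'. k \<noteq> k' \<and> (shift ^^ k) \<omega> = (shift ^^ k') \<omega>)"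

definition cyclic_word :: "(nat \<Rightarrow> nat) \<Rightarrow> bool" where
  "cyclic_word \<omega> \<longleftrightarrow> (\<exists>p>0. (shift ^^ p) \<omega> = \<omega>)"


section \<open>Representations of the Cuntz algebra\<close>

definition cuntz_rep :: "nat \<Rightarrow> (nat \<Rightarrow> 'a::chilbert_space \<Rightarrow> 'a) \<Rightarrow> bool" where
  "cuntz_rep N S \<longleftrightarrow>
    (\<forall>i<N. bounded_clinear (S i)) \<and>
    (\<forall>i<N. \<forall>j<N. \<forall>x. cadjoint (S i) (S j x) = (if i = j then x else 0)) \<and>
    (\<forall>x. (\<Sum>i<N. S i (cadjoint (S i) x)) = x)"

definition word_op :: "(nat \<Rightarrow> 'a::chilbert_space \<Rightarrow> 'a) \<Rightarrow> nat list \<Rightarrow> 'a \<Rightarrow> 'a" where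
  "word_op S I = foldr (\<lambda>i T. S i \<circ> T) I id"

text \<open>A projection valued measure is a total function on sets of words, of which only the
values on Borel subsets of \<^term>\<open>words N\<close> are relevant. Countable additivity is with respect to
the strong operator topology.\<close>

definition proj_valued_measure ::
  "nat \<Rightarrow> ((nat \<Rightarrow> nat) set \<Rightarrow> 'a::chilbert_space \<Rightarrow> 'a) \<Rightarrow> bool" where
  "proj_valued_measure N P \<longleftrightarrow>
    (\<forall>A\<in>borel_words N. orth_projection (P A)) \<and>
    P {} = (\<lambda>x. 0) \<and> P (words N) = id \<and>
    (\<forall>A\<in>borel_words N. \<forall>B\<in>borel_words N. P (A \<inter> B) = P A \<circ> P B) \<and>
    (\<forall>A. range A \<subseteq> borel_words N \<longrightarrow> disjoint_family A \<longrightarrow>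
      (\<forall>x. (\<lambda>n::nat. P (A n) x) sums P (\<Union>n. A n) x))"

text \<open>For a Cuntz representation these conditions determine \<open>P\<close> on the Borel sets.\<close>

definition associated_pvm ::
  "nat \<Rightarrow> (nat \<Rightarrow> 'a::chilbert_space \<Rightarrow> 'a) \<Rightarrow> ((nat \<Rightarrow> nat) set \<Rightarrow> 'a \<Rightarrow> 'a) \<Rightarrow> bool" where
  "associated_pvm N S P \<longleftrightarrow> proj_valued_measure N P \<and>
    (\<forall>I. set I \<subseteq> {..<N} \<longrightarrow> P (cylinder N I) = word_op S I \<circ> cadjoint (word_op S I))"

text \<open>The set \<open>\<Omega>\<close> may be uncountable when the Hilbert space is not separable, so the sum is an
unordered one. The projections of distinct points are orthogonal for every projection valued
measure.\<close>

definition purely_atomic ::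
  "nat \<Rightarrow> ((nat \<Rightarrow> nat) set \<Rightarrow> 'a::chilbert_space \<Rightarrow> 'a) \<Rightarrow> bool" where
  "purely_atomic N P \<longleftrightarrow> (\<exists>\<Omega>\<subseteq>words N. \<forall>x. ((\<lambda>\<omega>. P {\<omega>} x) has_sum x) \<Omega>)"

definition pvm_support ::
  "nat \<Rightarrow> ((nat \<Rightarrow> nat) set \<Rightarrow> 'a::chilbert_space \<Rightarrow> 'a) \<Rightarrow> (nat \<Rightarrow> nat) set" where
  "pvm_support N P = {\<omega> \<in> words N. P {\<omega>} \<noteq> (\<lambda>x. 0)}"

end

theory Submission
  imports Defs
begin

text \<open>Write \<open>T n\<close> for the adjoint of \<open>S\<^sub>I\<close> with \<open>I\<close> the prefix of length \<open>n\<close> of a word \<open>\<omega>\<close>. Since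
\<open>S\<^sub>I\<close> is an isometry whose range projection is \<open>P\<close> of the cylinder of \<open>I\<close>, and since these cylinders
shrink to \<open>\<omega>\<close>, the operator \<open>T n\<close> intertwines \<open>P {\<omega>}\<close> with \<open>P {\<sigma>\<^sup>n(\<omega>)}\<close> and is isometric on the range
of \<open>P {\<omega>}\<close> (\<open>atom_cadjoint_word_op\<close>, \<open>norm_cadjoint_word_op_atom\<close>), while it tends strongly to zero
on the kernel of \<open>P {\<omega>}\<close> (\<open>cadjoint_word_op_minus_atom_tendsto_0\<close>).

Let \<open>v\<close> be a vector of \<open>M\<close> with \<open>P {\<omega>} v \<noteq> 0\<close>. The vectors \<open>T n v\<close> lie in a ball of \<open>M\<close>, which is
compact because \<open>M\<close> has finite dimension (\<open>compact_cspan_Int_cball\<close>). Along a convergent subsequence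
with limit \<open>y\<close>, the component of \<open>T n v\<close> at \<open>\<sigma>\<^sup>n(\<omega>)\<close> has norm \<open>\<parallel>P {\<omega>} v\<parallel>\<close> and the rest tends to zero;
hence \<open>y \<noteq> 0\<close>, and \<open>P {\<sigma>\<^sup>n(\<omega>)} y\<close> tends to \<open>y\<close>. If the points \<open>\<sigma>\<^sup>n(\<omega>)\<close> were distinct, then these
components of the one vector \<open>y\<close> would tend to zero by countable additivity. So \<open>\<omega>\<close> is periodic, its
orbit is finite, and a point \<open>\<omega>'\<close> that the subsequence visits infinitely often is a cyclic word with
\<open>P {\<omega>'} y = y\<close> (\<open>periodic_if_atom_on_invariant_subspace\<close>).

Pure atomicity provides such an \<open>\<omega>\<close> for every \<open>v \<noteq> 0\<close> in \<open>M\<close>, which gives the first claim. It also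
writes \<open>v\<close> as the sum of its components at atoms, all of which are periodic by the above, so that
\<open>P\<close> of the set of periodic points of the support fixes \<open>v\<close>. This set is measurable because there are only
countably many periodic words (\<open>countable_periodic_words\<close>).

That the chosen adjoints are adjoints at all rests on completeness, through the Riesz representation
theorem.\<close>

section \<open>Geometry of the inner product\<close>

lemma cinner_add_left: "cinner (x + y) z = cinner x z + cinner y (z :: 'a::complex_inner)"
  by (metis cinner_add_right cinner_commute complex_cnj_add)

lemma cinner_scaleC_left: "cinner (a *\<^sub>C x) y = cnj a * cinner x (y :: 'a::complex_inner)"
  by (metis cinner_commute cinner_scaleC_right complex_cnj_mult)

lemma cinner_scaleR_right: "cinner x (r *\<^sub>R y) = of_real r * cinner x (y :: 'a::complex_inner)"
  by (simp add: scaleR_scaleC cinner_scaleC_right)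

lemma cinner_minus_right: "cinner x (- y) = - cinner x (y :: 'a::complex_inner)"
  using cinner_scaleR_right[of x "-1" y] by simp

lemma cinner_diff_right: "cinner x (y - z) = cinner x y - cinner x (z :: 'a::complex_inner)"
  by (metis add_diff_cancel_right' cinner_add_right diff_add_cancel)

lemma norm_sq_eq_cinner: "(norm x)\<^sup>2 = Re (cinner x (x :: 'a::complex_inner))"
  by (simp add: norm_eq_sqrt_cinner cinner_ge_zero)

lemma cinner_self_eq_norm: "cinner x x = of_real ((norm (x :: 'a::complex_inner))\<^sup>2)"
proof -
  have "Im (cinner x x) = 0"
    using cinner_commute[of x x] by (metis cnj.simps(2) neg_equal_zero)
  then show ?thesis
    by (simp add: norm_sq_eq_cinner complex_eq_iff)
qed

lemma norm_add_sq:
  "(norm (x + y))\<^sup>2 = (norm x)\<^sup>2 + 2 * Re (cinner x y) + (norm (y :: 'a::complex_inner))\<^sup>2"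
proof -
  have "Re (cinner y x) = Re (cinner x y)"
    by (metis cinner_commute cnj.simps(1))
  then show ?thesis
    by (simp add: norm_sq_eq_cinner cinner_add_left cinner_add_right)
qed

lemma norm_scaleC: "norm (a *\<^sub>C x) = norm a * norm (x :: 'a::complex_inner)"
proof -
  have "cinner (a *\<^sub>C x) (a *\<^sub>C x) = (a * cnj a) * cinner x x"
    by (simp add: cinner_scaleC_left cinner_scaleC_right)
  then have "(norm (a *\<^sub>C x))\<^sup>2 = (norm a * norm x)\<^sup>2"
    unfolding complex_norm_square[symmetric] cinner_self_eq_norm
    by (metis of_real_eq_iff of_real_mult power_mult_distrib)
  then show ?thesis
    by simp
qed

text \<open>The norm is already known to satisfy the triangle inequality, and squaring that inequality
bounds the real part of the inner product. Rotating one vector makes the inner product real.\<close>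

lemma Cauchy_Schwarz_cinner: "norm (cinner x y) \<le> norm x * norm (y :: 'a::complex_inner)"
proof -
  have real_part: "Re (cinner x z) \<le> norm x * norm z" for z
  proof -
    have "(norm (x + z))\<^sup>2 \<le> (norm x + norm z)\<^sup>2"
      by (simp add: norm_triangle_ineq power_mono)
    then show ?thesis
      unfolding norm_add_sq power2_sum by simp
  qed
  show ?thesis
  proof (cases "cinner x y = 0")
    case False
    define c where "c = cnj (cinner x y) / norm (cinner x y)"
    have "c * cinner x y = norm (cinner x y)"
      using False complex_norm_square[of "cinner x y"]
      by (simp add: c_def power2_eq_square field_simps)
    moreover have "norm c = 1"
      using False by (simp add: c_def norm_divide)
    ultimately show ?thesis
      using real_part[of "c *\<^sub>C y"] by (simp add: cinner_scaleC_right norm_scaleC)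
  qed simp
qed

lemma cinner_extensionality:
  fixes y z :: "'a::complex_inner"
  assumes "\<And>x. cinner x y = cinner x z"
  shows "y = z"
  using assms[of "y - z"] cinner_eq_zero_iff[of "y - z"] by (simp add: cinner_diff_right)


section \<open>Adjoints of bounded operators\<close>

text \<open>The representing vector of \<open>f\<close> minimizes \<open>\<parallel>x\<parallel>\<^sup>2 - 2 Re (f x)\<close>: the parallelogram law makes
every minimizing sequence a Cauchy sequence, and the first variation at the minimum vanishes.\<close>

lemma Riesz_representation:
  fixes f :: "'a::chilbert_space \<Rightarrow> complex"
  assumes "bounded_linear f" and f_scaleC: "\<And>c x. f (c *\<^sub>C x) = c * f x"
  shows "\<exists>z. \<forall>y. f y = cinner z y"
proof -
  interpret f: bounded_linear f by fact
  define \<phi> where "\<phi> x = (norm x)\<^sup>2 - 2 * Re (f x)" for x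
  define m where "m = Inf (range \<phi>)"
  obtain K where K: "\<And>x. norm (f x) \<le> norm x * K"
    using f.bounded by blast
  have "- K\<^sup>2 \<le> \<phi> x" for x
  proof -
    have "Re (f x) \<le> norm x * K"
      using K[of x] complex_Re_le_cmod order_trans by blast
    moreover have "0 \<le> (norm x - K)\<^sup>2"
      by simp
    ultimately show ?thesis
      by (simp add: \<phi>_def power2_diff)
  qed
  then have "bdd_below (range \<phi>)"
    by (metis bdd_belowI2)
  then have m_le: "m \<le> \<phi> x" for x
    by (simp add: m_def cInf_lower)
  have "\<exists>x. \<phi> x < m + 1 / Suc n" for n :: nat
    using cInf_lessD[of "range \<phi>" "m + 1 / Suc n"] by (auto simp: m_def)
  then obtain X where X: "\<And>n :: nat. \<phi> (X n) < m + 1 / Suc n"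
    by metis
  have parallelogram: "(norm (x - y))\<^sup>2 = 2 * \<phi> x + 2 * \<phi> y - 4 * \<phi> ((1/2) *\<^sub>R (x + y))" for x y
  proof -
    have "(norm ((1/2) *\<^sub>R (x + y)))\<^sup>2 = (norm (x + y))\<^sup>2 / 4"
      by (simp add: power_divide)
    moreover have "Re (f ((1/2) *\<^sub>R (x + y))) = (Re (f x) + Re (f y)) / 2"
      by (simp add: f.add f.scaleR)
    ultimately show ?thesis
      using norm_add_sq[of x "- y"] norm_add_sq[of x y] by (simp add: \<phi>_def cinner_minus_right)
  qed
  have X_close: "(norm (X i - X j))\<^sup>2 < e\<^sup>2" if "0 < e" "4 / e\<^sup>2 \<le> n" "n \<le> i" "n \<le> j" for e :: real and n i j :: nat
  proof -
    have "4 \<le> e\<^sup>2 * n"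
      using that by (simp add: field_simps)
    then have "0 < n"
      by (rule_tac ccontr) simp
    have "1 / Suc k < e\<^sup>2 / 4" if "n \<le> k" for k
    proof -
      have "e\<^sup>2 * n < e\<^sup>2 * Suc k"
        using that \<open>0 < e\<close> by (intro mult_strict_left_mono) auto
      then have "4 < e\<^sup>2 * Suc k"
        using \<open>4 \<le> e\<^sup>2 * n\<close> by linarith
      then show ?thesis
        by (simp add: field_simps)
    qed
    from this[OF \<open>n \<le> i\<close>] this[OF \<open>n \<le> j\<close>] show ?thesis
      unfolding parallelogram using X[of i] X[of j] m_le[of "(1/2) *\<^sub>R (X i + X j)"] by linarith
  qed
  have "Cauchy X"
  proof (rule CauchyI)
    fix e :: real
    assume "0 < e"
    obtain n :: nat where "4 / e\<^sup>2 \<le> n"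
      using real_arch_simple by blast
    have "norm (X i - X j) < e" if "n \<le> i" "n \<le> j" for i j
      using X_close[OF \<open>0 < e\<close> \<open>4 / e\<^sup>2 \<le> n\<close> that] \<open>0 < e\<close>
      by (simp add: power_less_imp_less_base)
    then show "\<exists>n. \<forall>i\<ge>n. \<forall>j\<ge>n. norm (X i - X j) < e"
      by blast
  qed
  then obtain z where z: "X \<longlonglongrightarrow> z"
    using Cauchy_convergent convergent_def by blast
  have "(\<lambda>n. \<phi> (X n)) \<longlonglongrightarrow> \<phi> z"
    unfolding \<phi>_def by (intro tendsto_intros f.tendsto z)
  moreover have "(\<lambda>n. m + 1 / Suc n) \<longlonglongrightarrow> m + 0"
    by (intro tendsto_intros LIMSEQ_Suc[OF lim_1_over_n])
  ultimately have "\<phi> z \<le> m"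
    using X by (intro LIMSEQ_le[of "\<lambda>n. \<phi> (X n)" _ "\<lambda>n. m + 1 / Suc n"]) (auto intro: less_imp_le)
  have Re_eq: "Re (f y) = Re (cinner z y)" for y
  proof -
    define a where "a = Re (cinner z y) - Re (f y)"
    have variation: "0 \<le> 2 * t * a + t\<^sup>2 * (norm y)\<^sup>2" for t :: real
    proof -
      have "\<phi> (z + t *\<^sub>R y) = \<phi> z + (2 * t * a + t\<^sup>2 * (norm y)\<^sup>2)"
        by (simp add: \<phi>_def a_def norm_add_sq f.add f.scaleR cinner_scaleR_right power_mult_distrib
            algebra_simps)
      then show ?thesis
        using \<open>\<phi> z \<le> m\<close> m_le[of "z + t *\<^sub>R y"] by linarith
    qed
    \<comment> \<open>The minimum of the quadratic polynomial in \<open>t\<close>; adding 1 covers the case \<open>y = 0\<close>.\<close>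
    define b where "b = (norm y)\<^sup>2 + 1"
    have "0 < b"
      by (simp add: b_def add_nonneg_pos)
    have "0 \<le> 2 * (- a / b) * a + (- a / b)\<^sup>2 * (b - 1)"
      using variation[of "- a / b"] by (simp add: b_def)
    also have "\<dots> = - (a\<^sup>2 * (b + 1)) / b\<^sup>2"
      using \<open>0 < b\<close> by (simp add: field_simps power2_eq_square)
    finally have "a\<^sup>2 * (b + 1) \<le> 0"
      using \<open>0 < b\<close> by (simp add: divide_le_0_iff zero_le_divide_iff)
    then have "a = 0"
      using \<open>0 < b\<close> by (simp add: mult_le_0_iff)
    then show ?thesis
      by (simp add: a_def)
  qed
  have "f y = cinner z y" for y
    using Re_eq[of y] Re_eq[of "\<i> *\<^sub>C y"] by (simp add: f_scaleC cinner_scaleC_right complex_eq_iff)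
  then show ?thesis
    by blast
qed

text \<open>The adjoint at \<open>y\<close> is the vector representing the functional \<open>x \<mapsto> \<langle>y, T x\<rangle>\<close>.\<close>

lemma cadjoint_works:
  fixes T :: "'a::chilbert_space \<Rightarrow> 'a"
  assumes "bounded_clinear T"
  shows "cinner (T x) y = cinner x (cadjoint T y)"
proof -
  interpret T: bounded_linear T
    using assms by (simp add: bounded_clinear_def)
  have "\<exists>z. \<forall>x. cinner (T x) y = cinner x z" for y
  proof -
    obtain K where K: "\<And>x. norm (T x) \<le> norm x * K"
      using T.bounded by blast
    have "bounded_linear (\<lambda>x. cinner y (T x))"
    proof (rule bounded_linear_intro)
      fix x
      have "norm (cinner y (T x)) \<le> norm y * norm (T x)"
        by (rule Cauchy_Schwarz_cinner)
      also have "\<dots> \<le> norm y * (norm x * K)"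
        by (simp add: K mult_left_mono)
      finally show "norm (cinner y (T x)) \<le> norm x * (norm y * K)"
        by (simp add: ac_simps)
    qed (simp_all add: T.add T.scaleR cinner_add_right cinner_scaleR_right scaleR_conv_of_real)
    moreover have "cinner y (T (c *\<^sub>C x)) = c * cinner y (T x)" for c x
      using assms by (simp add: bounded_clinear_def cinner_scaleC_right)
    ultimately obtain z where "\<forall>x. cinner y (T x) = cinner z x"
      using Riesz_representation[of "\<lambda>x. cinner y (T x)"] by blast
    then show ?thesis
      by (metis cinner_commute)
  qed
  then have "\<exists>T'. \<forall>x y. cinner (T x) y = cinner x (T' y)"
    by metis
  then show ?thesis
    unfolding cadjoint_def by (rule someI2_ex) blast
qed

lemma cadjoint_unique:
  fixes T :: "'a::chilbert_space \<Rightarrow> 'a"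
  assumes "bounded_clinear T" and "\<And>x y. cinner (T x) y = cinner x (T' y)"
  shows "cadjoint T = T'"
  using assms by (metis cadjoint_works cinner_extensionality ext)

lemma bounded_clinear_compose:
  "bounded_clinear T \<Longrightarrow> bounded_clinear U \<Longrightarrow> bounded_clinear (T \<circ> U)"
  by (auto simp: bounded_clinear_def comp_def intro: bounded_linear_compose)

lemma cadjoint_compose:
  fixes T U :: "'a::chilbert_space \<Rightarrow> 'a"
  assumes "bounded_clinear T" and "bounded_clinear U"
  shows "cadjoint (T \<circ> U) = cadjoint U \<circ> cadjoint T"
  by (intro cadjoint_unique bounded_clinear_compose assms) (simp add: assms cadjoint_works)

lemma norm_isometry:
  fixes T :: "'a::chilbert_space \<Rightarrow> 'a"
  assumes "bounded_clinear T" and "\<And>x. cadjoint T (T x) = x"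
  shows "norm (T x) = norm x"
  by (simp add: norm_eq_sqrt_cinner cadjoint_works assms)

text \<open>A common source of contraction estimates, for adjoints of isometries and for projections: divide
\<open>\<parallel>y\<parallel>\<^sup>2 \<le> \<parallel>x\<parallel> \<parallel>z\<parallel> \<le> \<parallel>x\<parallel> \<parallel>y\<parallel>\<close> by \<open>\<parallel>y\<parallel>\<close>.\<close>

lemma norm_le_from_cinner:
  fixes x y :: "'a::complex_inner"
  assumes "cinner y y = cinner x z" and "norm z \<le> norm y"
  shows "norm y \<le> norm x"
proof (cases "norm y = 0")
  case False
  have "norm y * norm y = norm (cinner y y)"
    by (simp add: cinner_self_eq_norm power2_eq_square norm_mult)
  also have "\<dots> \<le> norm x * norm y"
    using Cauchy_Schwarz_cinner[of x z] assms by (metis mult_left_mono norm_ge_zero order_trans)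
  finally show ?thesis
    using False by simp
qed simp

lemma norm_cadjoint_isometry_le:
  fixes T :: "'a::chilbert_space \<Rightarrow> 'a"
  assumes "bounded_clinear T" and "\<And>x. cadjoint T (T x) = x"
  shows "norm (cadjoint T x) \<le> norm x"
proof (rule norm_le_from_cinner)
  show "cinner (cadjoint T x) (cadjoint T x) = cinner x (T (cadjoint T x))"
    by (metis assms(1) cadjoint_works cinner_commute)
qed (simp add: norm_isometry assms)

lemma bounded_linear_cadjoint_isometry:
  fixes T :: "'a::chilbert_space \<Rightarrow> 'a"
  assumes "bounded_clinear T" and "\<And>x. cadjoint T (T x) = x"
  shows "bounded_linear (cadjoint T)"
proof (rule bounded_linear_intro)
  show "norm (cadjoint T x) \<le> norm x * 1" for x
    by (simp add: norm_cadjoint_isometry_le assms)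
qed (rule cinner_extensionality;
    simp add: cinner_add_right cinner_scaleR_right flip: cadjoint_works[OF assms(1)])+

lemma norm_orth_projection_le:
  fixes Q :: "'a::chilbert_space \<Rightarrow> 'a"
  assumes "orth_projection Q"
  shows "norm (Q x) \<le> norm x"
proof (rule norm_le_from_cinner)
  have "Q (Q x) = Q x"
    using assms unfolding orth_projection_def by (metis comp_apply)
  then show "cinner (Q x) (Q x) = cinner x (Q x)"
    using assms cadjoint_works[of Q x "Q x"] by (simp add: orth_projection_def)
qed simp


section \<open>Compactness in finite dimension\<close>

lemma bounded_linear_scaleC_left: "bounded_linear (\<lambda>a. a *\<^sub>C (x :: 'a::complex_inner))"
  by (rule bounded_linear_intro[where K = "norm x"])
    (simp_all add: scaleC_add_left scaleR_scaleC[where 'a = 'a] scaleC_scaleC norm_scaleC scaleR_conv_of_real)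

lemma closed_if_compact_Int_cball:
  fixes V :: "'a::real_normed_vector set"
  assumes "\<And>K. compact (V \<inter> cball 0 K)"
  shows "closed V"
  unfolding closed_sequential_limits
proof (intro allI impI)
  fix x l
  assume x: "(\<forall>n. x n \<in> V) \<and> x \<longlonglongrightarrow> l"
  then obtain K where "\<And>n. norm (x n) \<le> K"
    using convergent_imp_bounded[of x l] by (auto simp: bounded_iff)
  with x have "\<forall>n. x n \<in> V \<inter> cball 0 K"
    by simp
  with x have "l \<in> V \<inter> cball 0 K"
    using closed_sequentially[OF compact_imp_closed[OF assms]] by blast
  then show "l \<in> V"
    by simp
qed

text \<open>A generator \<open>b\<close> outside the span of \<open>B\<close> has distance \<open>d > 0\<close> from that closed subspace, so the
coefficient of \<open>b\<close> in a vector of norm at most \<open>K\<close> is bounded by \<open>K / d\<close>. Hence the ball of the larger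
span lies in a continuous image of a product of compact balls.\<close>

lemma compact_cspan_Int_cball:
  fixes B :: "'a::complex_inner set"
  assumes "finite B"
  shows "compact (cspan B \<inter> cball 0 K)"
  using assms
proof (induction B arbitrary: K)
  case empty
  have "finite ({0} \<inter> cball 0 K :: 'a set)"
    by simp
  then show ?case
    unfolding complex_vector.span_empty by (rule finite_imp_compact)
next
  case (insert b B)
  show ?case
  proof (cases "b \<in> cspan B")
    case True
    then show ?thesis
      using insert.IH by (simp add: complex_vector.span_redundant)
  next
    case False
    define d where "d = infdist b (cspan B)"
    have nonempty: "cspan B \<noteq> {}"
      using complex_vector.span_zero by blast
    have "0 < d"
      unfolding d_def using False nonempty closed_if_compact_Int_cball[OF insert.IH]
      by (intro infdist_pos_not_in_closed)
    have coeff: "norm a * d \<le> norm (a *\<^sub>C b + y)" if "y \<in> cspan B" for a y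
    proof (cases "a = 0")
      case False
      have "d \<le> dist b ((- inverse a) *\<^sub>C y)"
        unfolding d_def by (intro infdist_le complex_vector.span_scale that)
      also have "\<dots> = norm (b + inverse a *\<^sub>C y)"
        by (simp add: dist_norm complex_vector.scale_minus_left)
      finally have "norm a * d \<le> norm a * norm (b + inverse a *\<^sub>C y)"
        by (intro mult_left_mono) auto
      also have "\<dots> = norm (a *\<^sub>C b + y)"
        using False by (simp add: scaleC_add_right scaleC_scaleC scaleC_one flip: norm_scaleC)
      finally show ?thesis .
    qed simp
    define C where "C = (\<lambda>(a, y). a *\<^sub>C b + y) `
      (cball 0 (K / d) \<times> (cspan B \<inter> cball 0 (K + K / d * norm b)))"
    have "compact C"
      unfolding C_def case_prod_unfold
      by (intro compact_continuous_image compact_Times compact_cball insert.IH continuous_intros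
          bounded_linear.continuous_on[OF bounded_linear_scaleC_left])
    moreover have "cspan (insert b B) \<inter> cball 0 K = C \<inter> cball 0 K"
    proof (intro equalityI subsetI)
      fix x
      assume x: "x \<in> cspan (insert b B) \<inter> cball 0 K"
      then obtain a where a: "x - a *\<^sub>C b \<in> cspan B"
        by (auto simp: complex_vector.span_insert)
      have "norm a \<le> K / d"
        using coeff[OF a, of a] x \<open>0 < d\<close> by (simp add: field_simps)
      moreover have "norm (x - a *\<^sub>C b) \<le> K + K / d * norm b"
      proof -
        have "norm (x - a *\<^sub>C b) \<le> norm x + norm a * norm b"
          by (metis norm_scaleC norm_triangle_ineq4)
        also have "\<dots> \<le> K + K / d * norm b"
          using x \<open>norm a \<le> K / d\<close> by (intro add_mono mult_right_mono) auto
        finally show ?thesis .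
      qed
      ultimately show "x \<in> C \<inter> cball 0 K"
        using x a unfolding C_def by (auto intro!: image_eqI[of _ _ "(a, x - a *\<^sub>C b)"])
    next
      fix x
      assume x: "x \<in> C \<inter> cball 0 K"
      then obtain a y where "x = a *\<^sub>C b + y" "y \<in> cspan B"
        by (auto simp: C_def)
      then have "x \<in> cspan (insert b B)"
        by (auto simp: complex_vector.span_insert intro: exI[of _ a])
      with x show "x \<in> cspan (insert b B) \<inter> cball 0 K"
        by simp
    qed
    ultimately show ?thesis
      by (simp add: compact_Int_closed)
  qed
qed


section \<open>Words\<close>

definition word_prefix :: "(nat \<Rightarrow> nat) \<Rightarrow> nat \<Rightarrow> nat list" where
  "word_prefix \<omega> n = map \<omega> [0..<n]"

lemma shift_pow_apply: "(shift ^^ n) \<omega> k = \<omega> (n + k)"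
  by (induction n arbitrary: k) (simp_all add: shift_def)

lemma shift_pow_in_words: "\<omega> \<in> words N \<Longrightarrow> (shift ^^ n) \<omega> \<in> words N"
  by (simp add: words_def shift_pow_apply)

lemma set_word_prefix: "\<omega> \<in> words N \<Longrightarrow> set (word_prefix \<omega> n) \<subseteq> {..<N}"
  by (auto simp: word_prefix_def words_def)

lemma word_prefix_add: "word_prefix \<omega> (n + m) = word_prefix \<omega> n @ word_prefix ((shift ^^ n) \<omega>) m"
  by (rule nth_equalityI) (auto simp: word_prefix_def shift_pow_apply nth_append)

lemma cylinder_word_prefix: "cylinder N (word_prefix \<omega> n) = {\<eta> \<in> words N. \<forall>j<n. \<eta> j = \<omega> j}"
  by (simp add: cylinder_def word_prefix_def)

lemma Inter_cylinder_word_prefix: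
  assumes "\<omega> \<in> words N"
  shows "(\<Inter>n. cylinder N (word_prefix \<omega> n)) = {\<omega>}"
proof -
  have "\<eta> = \<omega>" if "\<eta> \<in> (\<Inter>n. cylinder N (word_prefix \<omega> n))" for \<eta>
  proof
    fix j
    have "\<eta> \<in> cylinder N (word_prefix \<omega> (Suc j))"
      using that by blast
    then show "\<eta> j = \<omega> j"
      by (simp add: cylinder_word_prefix)
  qed
  moreover have "\<omega> \<in> (\<Inter>n. cylinder N (word_prefix \<omega> n))"
    using assms by (simp add: cylinder_word_prefix)
  ultimately show ?thesis
    by blast
qed

lemma borel_Int_words: "A \<in> sets borel \<Longrightarrow> words N \<inter> A \<in> borel_words N"
  by (auto simp: borel_words_def sets_restrict_space)

lemma countable_in_borel_words:
  assumes "countable A" and "A \<subseteq> words N"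
  shows "A \<in> borel_words N"
proof -
  have "{\<omega>} \<in> sets borel" for \<omega> :: "nat \<Rightarrow> nat"
  proof -
    have "closed (\<Inter>k. {\<eta> :: nat \<Rightarrow> nat. \<eta> k = \<omega> k})"
      by (intro closed_INT ballI closed_Collect_eq continuous_on_product_coordinates continuous_on_const)
    moreover have "(\<Inter>k. {\<eta>. \<eta> k = \<omega> k}) = {\<omega>}"
      by (auto simp: fun_eq_iff)
    ultimately show ?thesis
      by (metis borel_closed)
  qed
  then have "A \<in> sets borel"
    by (rule sets.countable[OF _ assms(1)])
  with assms show ?thesis
    using borel_Int_words[of A N] by (simp add: Int_absorb1)
qed

lemma singleton_in_borel_words: "\<omega> \<in> words N \<Longrightarrow> {\<omega>} \<in> borel_words N"
  by (simp add: countable_in_borel_words)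

lemma cylinder_in_borel_words: "cylinder N I \<in> borel_words N"
proof -
  have "closed (\<Inter>j<length I. {\<omega> :: nat \<Rightarrow> nat. \<omega> j = I ! j})"
    by (intro closed_INT ballI closed_Collect_eq continuous_on_product_coordinates continuous_on_const)
  then have "words N \<inter> (\<Inter>j<length I. {\<omega>. \<omega> j = I ! j}) \<in> borel_words N"
    by (intro borel_Int_words borel_closed)
  moreover have "cylinder N I = words N \<inter> (\<Inter>j<length I. {\<omega>. \<omega> j = I ! j})"
    by (auto simp: cylinder_def)
  ultimately show ?thesis
    by simp
qed

text \<open>A word with \<open>\<sigma>\<^sup>k(\<omega>) = \<sigma>\<^sup>l(\<omega>)\<close> and \<open>k < l\<close> is determined by \<open>k\<close>, \<open>l\<close> and its first \<open>l\<close> letters.\<close>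

lemma countable_periodic_words: "countable {\<omega>. periodic_word \<omega>}"
proof -
  have "countable {\<omega>. (shift ^^ k) \<omega> = (shift ^^ l) \<omega>}" if "k < l" for k l
  proof -
    have "inj_on (\<lambda>\<omega>. word_prefix \<omega> l) {\<omega>. (shift ^^ k) \<omega> = (shift ^^ l) \<omega>}"
    proof (rule inj_onI)
      fix \<omega> \<eta> :: "nat \<Rightarrow> nat"
      assume \<omega>: "\<omega> \<in> {\<omega>. (shift ^^ k) \<omega> = (shift ^^ l) \<omega>}"
        and \<eta>: "\<eta> \<in> {\<omega>. (shift ^^ k) \<omega> = (shift ^^ l) \<omega>}"
        and eq: "word_prefix \<omega> l = word_prefix \<eta> l"
      have "\<omega> n = \<eta> n" for n
      proof (induction n rule: less_induct)
        case (less n)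
        show ?case
        proof (cases "n < l")
          case True
          with eq show ?thesis
            by (simp add: word_prefix_def)
        next
          case False
          define j where "j = n - l"
          have n: "n = l + j" and "k + j < n"
            using False that by (simp_all add: j_def)
          have repeat: "\<xi> n = \<xi> (k + j)" if "(shift ^^ k) \<xi> = (shift ^^ l) \<xi>" for \<xi> :: "nat \<Rightarrow> nat"
            using fun_cong[OF that, of j] by (simp add: shift_pow_apply n)
          have "\<omega> n = \<omega> (k + j)" and "\<eta> n = \<eta> (k + j)"
            using \<omega> \<eta> repeat by simp_all
          then show ?thesis
            using less.IH[OF \<open>k + j < n\<close>] by simp
        qed
      qed
      then show "\<omega> = \<eta>"
        by blast
    qed
    then show ?thesis
      by (rule countableI')
  qed
  then have "countable (\<Union>l. \<Union>k<l. {\<omega>. (shift ^^ k) \<omega> = (shift ^^ l) \<omega>})"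
    by (intro countable_UN) auto
  moreover have "{\<omega>. periodic_word \<omega>} \<subseteq> (\<Union>l. \<Union>k<l. {\<omega>. (shift ^^ k) \<omega> = (shift ^^ l) \<omega>})"
  proof
    fix \<omega>
    assume "\<omega> \<in> {\<omega>. periodic_word \<omega>}"
    then obtain k l where "k \<noteq> l" and "(shift ^^ k) \<omega> = (shift ^^ l) \<omega>"
      by (auto simp: periodic_word_def)
    then have "\<exists>k l. k < l \<and> (shift ^^ k) \<omega> = (shift ^^ l) \<omega>"
      by (metis linorder_neqE_nat)
    then show "\<omega> \<in> (\<Union>l. \<Union>k<l. {\<omega>. (shift ^^ k) \<omega> = (shift ^^ l) \<omega>})"
      by auto
  qed
  ultimately show ?thesis
    by (rule countable_subset[rotated])
qed

lemma finite_orbit_periodic_word: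
  assumes "periodic_word \<omega>"
  shows "finite (range (\<lambda>n. (shift ^^ n) \<omega>))"
proof -
  have "\<exists>k l. k < l \<and> (shift ^^ k) \<omega> = (shift ^^ l) \<omega>"
    using assms unfolding periodic_word_def by (metis linorder_neqE_nat)
  then obtain k l where kl: "k < l" "(shift ^^ k) \<omega> = (shift ^^ l) \<omega>"
    by blast
  have "(shift ^^ n) \<omega> \<in> (\<lambda>n. (shift ^^ n) \<omega>) ` {..<l}" for n
  proof (induction n rule: less_induct)
    case (less n)
    show ?case
    proof (cases "n < l")
      case False
      then have "(shift ^^ n) \<omega> = (shift ^^ (n - l)) ((shift ^^ l) \<omega>)"
        by (metis funpow_add comp_apply le_add_diff_inverse2 linorder_not_less)
      also have "\<dots> = (shift ^^ (n - l + k)) \<omega>"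
        by (simp add: funpow_add flip: kl(2))
      finally show ?thesis
        using less.IH[of "n - l + k"] False kl(1) by simp
    qed simp
  qed
  then show ?thesis
    by (meson finite_imageI finite_lessThan finite_subset image_subsetI)
qed

lemma cyclic_word_shift_pow:
  assumes "a < b" and "(shift ^^ a) \<omega> = (shift ^^ b) \<omega>"
  shows "cyclic_word ((shift ^^ a) \<omega>)"
proof -
  have "(shift ^^ (b - a)) ((shift ^^ a) \<omega>) = (shift ^^ b) \<omega>"
    using assms(1) by (metis comp_apply funpow_add le_add_diff_inverse2 less_imp_le)
  with assms show ?thesis
    unfolding cyclic_word_def by (metis zero_less_diff)
qed


section \<open>Projection valued measures\<close>

context
  fixes N :: nat and P :: "(nat \<Rightarrow> nat) set \<Rightarrow> 'a::chilbert_space \<Rightarrow> 'a"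
  assumes pvm: "proj_valued_measure N P"
begin

lemma pvm_orth_projection: "A \<in> borel_words N \<Longrightarrow> orth_projection (P A)"
  using pvm by (simp add: proj_valued_measure_def)

lemma pvm_bounded_linear: "A \<in> borel_words N \<Longrightarrow> bounded_linear (P A)"
  using pvm_orth_projection by (simp add: orth_projection_def bounded_clinear_def)

lemma pvm_Int: "A \<in> borel_words N \<Longrightarrow> B \<in> borel_words N \<Longrightarrow> P A (P B x) = P (A \<inter> B) x"
  using pvm by (simp add: proj_valued_measure_def)

lemma pvm_empty: "P {} x = 0"
  using pvm by (simp add: proj_valued_measure_def)

lemma pvm_sums:
  "range A \<subseteq> borel_words N \<Longrightarrow> disjoint_family A \<Longrightarrow> (\<lambda>n::nat. P (A n) x) sums P (\<Union>n. A n) x"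
  using pvm by (simp add: proj_valued_measure_def)

lemma pvm_Diff:
  assumes "A \<in> borel_words N" and "B \<in> borel_words N" and "A \<subseteq> B"
  shows "P (B - A) x = P B x - P A x"
proof -
  have "B - A \<in> borel_words N"
    using assms unfolding borel_words_def by blast
  moreover have "{} \<in> borel_words N"
    by (simp add: borel_words_def)
  moreover have "disjoint_family (binaryset A (B - A))"
    by (auto simp: disjoint_family_on_def binaryset_def)
  ultimately have "(\<lambda>n. P (binaryset A (B - A) n) x) sums P (A \<union> (B - A)) x"
    using pvm_sums[of "binaryset A (B - A)" x] assms(1)
    by (simp add: range_binaryset_eq UN_binaryset_eq)
  moreover have "(\<lambda>n. P (binaryset A (B - A) n) x) sums (P A x + P (B - A) x)"
    by (rule binaryset_sums) (rule pvm_empty)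
  ultimately have "P (A \<union> (B - A)) x = P A x + P (B - A) x"
    by (rule sums_unique2)
  then show ?thesis
    using assms(3) by (simp add: Un_absorb1)
qed

text \<open>Continuity from above: the successive differences of the sequence are disjoint, and their
partial sums telescope.\<close>

lemma pvm_tendsto_INT:
  assumes A: "range A \<subseteq> borel_words N" and "decseq A"
  shows "(\<lambda>n. P (A n) x) \<longlonglongrightarrow> P (\<Inter>n. A n) x"
proof -
  define D where "D n = A n - A (Suc n)" for n
  have A_in: "A n \<in> borel_words N" for n
    using A by blast
  have INT_in: "(\<Inter>n. A n) \<in> borel_words N"
    using A unfolding borel_words_def by (intro sets.countable_INT) auto
  have "range D \<subseteq> borel_words N"
    using A_in unfolding D_def borel_words_def by blast
  moreover have "disjoint_family D"
  proof -
    have "D m \<inter> D n = {}" if "m < n" for m n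
      using decseqD[OF \<open>decseq A\<close>, of "Suc m" n] that by (auto simp: D_def)
    then show ?thesis
      unfolding disjoint_family_on_def by (metis Int_commute linorder_neqE_nat)
  qed
  moreover have "(\<Union>n. D n) = A 0 - (\<Inter>n. A n)"
  proof (intro equalityI subsetI)
    fix w
    assume "w \<in> (\<Union>n. D n)"
    then show "w \<in> A 0 - (\<Inter>n. A n)"
      using decseqD[OF \<open>decseq A\<close>, of 0] by (auto simp: D_def)
  next
    fix w
    assume w: "w \<in> A 0 - (\<Inter>n. A n)"
    define k where "k = (LEAST n. w \<notin> A n)"
    have "\<exists>n. w \<notin> A n"
      using w by blast
    then have k: "w \<notin> A k"
      unfolding k_def by (rule LeastI_ex)
    with w obtain j where "k = Suc j"
      by (cases k) auto
    moreover from this have "w \<in> A j"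
      using not_less_Least[of j "\<lambda>n. w \<notin> A n"] by (simp add: k_def)
    ultimately show "w \<in> (\<Union>n. D n)"
      using k by (auto simp: D_def)
  qed
  moreover have "P (A 0 - (\<Inter>n. A n)) x = P (A 0) x - P (\<Inter>n. A n) x"
    using INT_in A_in by (rule pvm_Diff) blast
  ultimately have "(\<lambda>n. P (D n) x) sums (P (A 0) x - P (\<Inter>n. A n) x)"
    using pvm_sums[of D x] by simp
  then have "(\<lambda>n. P (A 0) x - (\<Sum>i<n. P (D i) x)) \<longlonglongrightarrow> P (A 0) x - (P (A 0) x - P (\<Inter>n. A n) x)"
    unfolding sums_def by (intro tendsto_intros)
  moreover have "(\<Sum>i<n. P (D i) x) = P (A 0) x - P (A n) x" for n
  proof (induction n)
    case (Suc n)
    have "P (D n) x = P (A n) x - P (A (Suc n)) x"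
      unfolding D_def using decseq_SucD[OF \<open>decseq A\<close>] by (intro pvm_Diff A_in)
    with Suc show ?case
      by simp
  qed simp
  ultimately show ?thesis
    by simp
qed

lemma pvm_cylinder_tendsto_atom:
  assumes "\<omega> \<in> words N"
  shows "(\<lambda>n. P (cylinder N (word_prefix \<omega> n)) x) \<longlonglongrightarrow> P {\<omega>} x"
proof -
  have "decseq (\<lambda>n. cylinder N (word_prefix \<omega> n))"
    by (rule decseq_SucI) (auto simp: cylinder_word_prefix)
  then have "(\<lambda>n. P (cylinder N (word_prefix \<omega> n)) x) \<longlonglongrightarrow> P (\<Inter>n. cylinder N (word_prefix \<omega> n)) x"
    by (intro pvm_tendsto_INT) (auto simp: cylinder_in_borel_words)
  with assms show ?thesis
    by (simp add: Inter_cylinder_word_prefix)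
qed

text \<open>Countable additivity makes the sum of the components of \<open>x\<close> at distinct points converge. This is
what excludes words with an infinite orbit.\<close>

lemma pvm_distinct_atoms_tendsto_0:
  assumes "inj f" and "\<And>k. f k \<in> words N"
  shows "(\<lambda>k::nat. P {f k} x) \<longlonglongrightarrow> 0"
proof -
  have "disjoint_family (\<lambda>k. {f k})"
    using assms(1) by (auto simp: disjoint_family_on_def dest: injD)
  then have "(\<lambda>k. P {f k} x) sums P (\<Union>k. {f k}) x"
    using assms(2) by (intro pvm_sums) (auto simp: singleton_in_borel_words)
  then show ?thesis
    by (intro summable_LIMSEQ_zero sums_summable)
qed

text \<open>A vector is the sum of its components at the atoms, and \<open>P A\<close> fixes every component at a point of
\<open>A\<close>; so it fixes a vector all of whose non-zero components are at points of \<open>A\<close>.\<close>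

lemma in_range_if_atoms_in:
  assumes "purely_atomic N P" and A: "A \<in> borel_words N"
    and "\<And>\<omega>. \<omega> \<in> words N \<Longrightarrow> P {\<omega>} v \<noteq> 0 \<Longrightarrow> \<omega> \<in> A"
  shows "v \<in> range (P A)"
proof -
  obtain \<Omega> where \<Omega>: "\<Omega> \<subseteq> words N" and sum: "\<And>x. ((\<lambda>\<omega>. P {\<omega>} x) has_sum x) \<Omega>"
    using assms(1) unfolding purely_atomic_def by blast
  have "P A (P {\<omega>} v) = P {\<omega>} v" if "\<omega> \<in> \<Omega>" for \<omega>
  proof (cases "\<omega> \<in> A")
    case True
    then show ?thesis
      using that \<Omega> A by (simp add: pvm_Int singleton_in_borel_words subset_iff)
  next
    case False
    then have "P {\<omega>} v = 0"
      using that \<Omega> assms(3) by blast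
    then show ?thesis
      using pvm_bounded_linear[OF A] by (simp add: linear_simps)
  qed
  moreover have "((\<lambda>\<omega>. P A (P {\<omega>} v)) has_sum P A v) \<Omega>"
    using sum by (rule has_sum_bounded_linear[OF pvm_bounded_linear[OF A]])
  ultimately have "((\<lambda>\<omega>. P {\<omega>} v) has_sum P A v) \<Omega>"
    by (simp cong: has_sum_cong)
  with sum have "P A v = v"
    by (rule has_sum_unique[rotated])
  then show ?thesis
    by (metis rangeI)
qed

end


section \<open>The action of the Cuntz isometries on atoms\<close>

lemma word_op_Nil: "word_op S [] = id"
  by (simp add: word_op_def)

lemma word_op_Cons: "word_op S (i # I) = S i \<circ> word_op S I"
  by (simp add: word_op_def)

lemma word_op_append: "word_op S (I @ J) x = word_op S I (word_op S J x)"
  by (induction I) (simp_all add: word_op_Nil word_op_Cons)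

context
  fixes N :: nat and S :: "nat \<Rightarrow> 'a::chilbert_space \<Rightarrow> 'a"
  assumes cuntz: "cuntz_rep N S"
begin

lemma bounded_clinear_letter: "i < N \<Longrightarrow> bounded_clinear (S i)"
  using cuntz by (simp add: cuntz_rep_def)

lemma bounded_clinear_word_op: "set I \<subseteq> {..<N} \<Longrightarrow> bounded_clinear (word_op S I)"
proof (induction I)
  case Nil
  then show ?case
    by (simp add: word_op_Nil bounded_clinear_def id_def bounded_linear_ident)
next
  case (Cons i I)
  then show ?case
    unfolding word_op_Cons by (intro bounded_clinear_compose bounded_clinear_letter) simp_all
qed

lemma cadjoint_word_op_Nil: "cadjoint (word_op S []) = (\<lambda>x. x)"
  using bounded_clinear_word_op[of "[]"] by (intro cadjoint_unique) (simp_all add: word_op_Nil)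

lemma cadjoint_word_op_Cons:
  "i < N \<Longrightarrow> set I \<subseteq> {..<N} \<Longrightarrow>
    cadjoint (word_op S (i # I)) x = cadjoint (word_op S I) (cadjoint (S i) x)"
  unfolding word_op_Cons
  by (subst cadjoint_compose) (simp_all add: bounded_clinear_letter bounded_clinear_word_op)

lemma cadjoint_word_op_append:
  "set I \<subseteq> {..<N} \<Longrightarrow> set J \<subseteq> {..<N} \<Longrightarrow>
    cadjoint (word_op S (I @ J)) x = cadjoint (word_op S J) (cadjoint (word_op S I) x)"
proof (induction I arbitrary: x)
  case (Cons i I)
  then show ?case
    using cadjoint_word_op_Cons[of i "I @ J"] cadjoint_word_op_Cons[of i I] by simp
qed (use cadjoint_word_op_Nil in simp)

lemma cadjoint_word_op_cancel:
  "set I \<subseteq> {..<N} \<Longrightarrow> cadjoint (word_op S I) (word_op S I x) = x"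
proof (induction I arbitrary: x)
  case (Cons i I)
  moreover have "cadjoint (S i) (S i y) = y" for y
    using cuntz Cons.prems by (simp add: cuntz_rep_def)
  ultimately show ?case
    using cadjoint_word_op_Cons[of i I "word_op S (i # I) x"] word_op_append[of S "[i]" I x]
    by (simp add: word_op_Cons[of S i "[]"] word_op_Nil)
qed (use cadjoint_word_op_Nil in \<open>simp add: word_op_Nil\<close>)

lemma cadjoint_word_op_invariant:
  assumes "\<forall>i<N. cadjoint (S i) ` M \<subseteq> M"
  shows "set I \<subseteq> {..<N} \<Longrightarrow> v \<in> M \<Longrightarrow> cadjoint (word_op S I) v \<in> M"
proof (induction I arbitrary: v)
  case (Cons i I)
  then have "cadjoint (S i) v \<in> M"
    using assms by auto
  then show ?case
    using Cons cadjoint_word_op_Cons[of i I v] by simp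
qed (use cadjoint_word_op_Nil in simp)

lemma norm_word_op: "set I \<subseteq> {..<N} \<Longrightarrow> norm (word_op S I x) = norm x"
  by (simp add: norm_isometry bounded_clinear_word_op cadjoint_word_op_cancel)

lemma norm_cadjoint_word_op_le: "set I \<subseteq> {..<N} \<Longrightarrow> norm (cadjoint (word_op S I) x) \<le> norm x"
  by (simp add: norm_cadjoint_isometry_le bounded_clinear_word_op cadjoint_word_op_cancel)

lemma bounded_linear_cadjoint_word_op:
  "set I \<subseteq> {..<N} \<Longrightarrow> bounded_linear (cadjoint (word_op S I))"
  by (simp add: bounded_linear_cadjoint_isometry bounded_clinear_word_op cadjoint_word_op_cancel)

end

context
  fixes N :: nat and S :: "nat \<Rightarrow> 'a::chilbert_space \<Rightarrow> 'a"
    and P :: "(nat \<Rightarrow> nat) set \<Rightarrow> 'a \<Rightarrow> 'a"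
  assumes cuntz: "cuntz_rep N S" and assoc: "associated_pvm N S P"
begin

lemma pvm: "proj_valued_measure N P"
  using assoc by (simp add: associated_pvm_def)

lemma pvm_cylinder:
  "set I \<subseteq> {..<N} \<Longrightarrow> P (cylinder N I) x = word_op S I (cadjoint (word_op S I) x)"
  using assoc by (simp add: associated_pvm_def)

lemma norm_cadjoint_word_op:
  "set I \<subseteq> {..<N} \<Longrightarrow> norm (cadjoint (word_op S I) x) = norm (P (cylinder N I) x)"
  by (simp add: pvm_cylinder norm_word_op[OF cuntz])

lemma pvm_cylinder_cadjoint_word_op:
  assumes "set I \<subseteq> {..<N}" and "set J \<subseteq> {..<N}"
  shows "P (cylinder N J) (cadjoint (word_op S I) x) = cadjoint (word_op S I) (P (cylinder N (I @ J)) x)"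
proof -
  show ?thesis
    using assms
    by (simp add: pvm_cylinder word_op_append cadjoint_word_op_append[OF cuntz]
        cadjoint_word_op_cancel[OF cuntz])
qed

text \<open>Reading off the first \<open>n\<close> letters of \<open>\<omega>\<close> moves the atom at \<open>\<omega>\<close> to the atom at \<open>\<sigma>\<^sup>n(\<omega>)\<close>; this is the
limit of the corresponding relation between cylinders.\<close>

lemma atom_cadjoint_word_op:
  assumes \<omega>: "\<omega> \<in> words N"
  shows "P {(shift ^^ n) \<omega>} (cadjoint (word_op S (word_prefix \<omega> n)) x) =
    cadjoint (word_op S (word_prefix \<omega> n)) (P {\<omega>} x)"
proof (rule LIMSEQ_unique)
  let ?T = "cadjoint (word_op S (word_prefix \<omega> n))"
  show "(\<lambda>m. P (cylinder N (word_prefix ((shift ^^ n) \<omega>) m)) (?T x)) \<longlonglongrightarrow> P {(shift ^^ n) \<omega>} (?T x)"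
    by (intro pvm_cylinder_tendsto_atom pvm shift_pow_in_words \<omega>)
  have "(\<lambda>m. P (cylinder N (word_prefix \<omega> (m + n))) x) \<longlonglongrightarrow> P {\<omega>} x"
    by (rule LIMSEQ_ignore_initial_segment[OF pvm_cylinder_tendsto_atom[OF pvm \<omega>]])
  then have "(\<lambda>m. ?T (P (cylinder N (word_prefix \<omega> (n + m))) x)) \<longlonglongrightarrow> ?T (P {\<omega>} x)"
    by (intro bounded_linear.tendsto[OF bounded_linear_cadjoint_word_op[OF cuntz set_word_prefix[OF \<omega>]]])
      (simp add: add.commute)
  then show "(\<lambda>m. P (cylinder N (word_prefix ((shift ^^ n) \<omega>) m)) (?T x)) \<longlonglongrightarrow> ?T (P {\<omega>} x)"
    by (simp add: pvm_cylinder_cadjoint_word_op set_word_prefix shift_pow_in_words \<omega> word_prefix_add)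
qed

text \<open>On the range of an atom the adjoints act isometrically along the letters of \<open>\<omega>\<close>, since that range
lies in the range of each \<open>S\<^sub>I\<close> with \<open>I\<close> a prefix of \<open>\<omega>\<close>.\<close>

lemma norm_cadjoint_word_op_atom:
  assumes \<omega>: "\<omega> \<in> words N"
  shows "norm (cadjoint (word_op S (word_prefix \<omega> n)) (P {\<omega>} x)) = norm (P {\<omega>} x)"
proof -
  have "cylinder N (word_prefix \<omega> n) \<inter> {\<omega>} = {\<omega>}"
    using \<omega> by (simp add: cylinder_word_prefix)
  then show ?thesis
    by (simp add: norm_cadjoint_word_op set_word_prefix \<omega> pvm_Int[OF pvm] cylinder_in_borel_words
        singleton_in_borel_words)
qed

text \<open>The part of \<open>x\<close> orthogonal to the atom at \<open>\<omega>\<close> has components in the cylinders around \<open>\<omega>\<close> that tend to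
zero, and the norms of these components are those of the differences below. Thus the images of \<open>x\<close>
come arbitrarily close to the ranges of the moving atoms.\<close>

lemma cadjoint_word_op_minus_atom_tendsto_0:
  assumes \<omega>: "\<omega> \<in> words N"
  shows "(\<lambda>n. cadjoint (word_op S (word_prefix \<omega> n)) x -
    P {(shift ^^ n) \<omega>} (cadjoint (word_op S (word_prefix \<omega> n)) x)) \<longlonglongrightarrow> 0"
proof (rule tendsto_norm_zero_cancel)
  let ?T = "\<lambda>n. cadjoint (word_op S (word_prefix \<omega> n))"
  have "P {\<omega>} (x - P {\<omega>} x) = 0"
    using \<omega> pvm_bounded_linear[OF pvm, of "{\<omega>}"] pvm_Int[OF pvm, of "{\<omega>}" "{\<omega>}" x]
    by (simp add: singleton_in_borel_words linear_simps)
  then have "(\<lambda>n. norm (P (cylinder N (word_prefix \<omega> n)) (x - P {\<omega>} x))) \<longlonglongrightarrow> 0"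
    using tendsto_norm[OF pvm_cylinder_tendsto_atom[OF pvm \<omega>, of "x - P {\<omega>} x"]] by simp
  moreover have "norm (P (cylinder N (word_prefix \<omega> n)) (x - P {\<omega>} x)) =
      norm (?T n x - P {(shift ^^ n) \<omega>} (?T n x))" for n
    using \<omega> bounded_linear_cadjoint_word_op[OF cuntz set_word_prefix[OF \<omega>, of n]]
    by (simp add: atom_cadjoint_word_op linear_simps set_word_prefix flip: norm_cadjoint_word_op)
  ultimately show "(\<lambda>n. norm (?T n x - P {(shift ^^ n) \<omega>} (?T n x))) \<longlonglongrightarrow> 0"
    by simp
qed

section \<open>Finite dimensional invariant subspaces\<close>

text \<open>The images \<open>x n\<close> of \<open>v\<close> under the adjoints along \<open>\<omega>\<close> form a bounded sequence in \<open>M\<close>, and their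
components at \<open>\<sigma>\<^sup>n(\<omega>)\<close> have constant norm and absorb all of \<open>x n\<close> in the limit. A limit point \<open>y\<close> of the
sequence is therefore non-zero and almost fixed by infinitely many of the projections
\<open>P {\<sigma>\<^sup>n(\<omega>)}\<close>. This forces the orbit of \<open>\<omega>\<close> to be finite, and then \<open>y\<close> is fixed by the projection at a
point that the orbit visits again and again.\<close>

lemma periodic_if_atom_on_invariant_subspace:
  assumes inv: "\<forall>i<N. cadjoint (S i) ` M \<subseteq> M" and compact: "\<And>K. compact (M \<inter> cball 0 K)"
    and v: "v \<in> M" and \<omega>: "\<omega> \<in> words N" and nonzero: "P {\<omega>} v \<noteq> 0"
  shows "periodic_word \<omega>"
    and "\<exists>\<omega>'\<in>words N. cyclic_word \<omega>' \<and> (\<exists>y\<in>M. y \<noteq> 0 \<and> P {\<omega>'} y = y)"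
proof -
  define x where "x n = cadjoint (word_op S (word_prefix \<omega> n)) v" for n
  have "\<forall>n. x n \<in> M \<inter> cball 0 (norm v)"
    unfolding x_def
    using v \<omega> by (simp add: cadjoint_word_op_invariant[OF cuntz inv] norm_cadjoint_word_op_le[OF cuntz]
        set_word_prefix)
  then obtain y r where "y \<in> M \<inter> cball 0 (norm v)"
    and r: "strict_mono (r :: nat \<Rightarrow> nat)" and lim: "(x \<circ> r) \<longlonglongrightarrow> y"
    by (rule seq_compactE[OF compact_imp_seq_compact[OF compact]])
  then have "y \<in> M"
    by simp
  define \<eta> where "\<eta> k = (shift ^^ r k) \<omega>" for k
  have \<eta>: "\<eta> k \<in> words N" for k
    by (simp add: \<eta>_def shift_pow_in_words \<omega>)
  have "((\<lambda>n. x n - P {(shift ^^ n) \<omega>} (x n)) \<circ> r) \<longlonglongrightarrow> 0"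
    unfolding x_def by (intro LIMSEQ_subseq_LIMSEQ cadjoint_word_op_minus_atom_tendsto_0 \<omega> r)
  then have "(\<lambda>k. (x \<circ> r) k - (x (r k) - P {\<eta> k} (x (r k)))) \<longlonglongrightarrow> y - 0"
    by (intro tendsto_diff lim) (simp add: comp_def \<eta>_def)
  then have lim_atoms: "(\<lambda>k. P {\<eta> k} (x (r k))) \<longlonglongrightarrow> y"
    by simp
  have "norm (P {\<eta> k} (x (r k))) = norm (P {\<omega>} v)" for k
    by (simp add: \<eta>_def x_def atom_cadjoint_word_op norm_cadjoint_word_op_atom \<omega>)
  with tendsto_norm[OF lim_atoms] have "norm y = norm (P {\<omega>} v)"
    by (simp add: LIMSEQ_const_iff)
  with nonzero have "y \<noteq> 0"
    by auto
  \<comment> \<open>Projections are contractions, so \<open>x (r k)\<close> may be replaced by its limit.\<close>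
  have "(\<lambda>k. P {\<eta> k} (x (r k) - y)) \<longlonglongrightarrow> 0"
  proof (rule Lim_null_comparison)
    show "\<forall>\<^sub>F k in sequentially. norm (P {\<eta> k} (x (r k) - y)) \<le> norm ((x \<circ> r) k - y)"
      by (simp add: norm_orth_projection_le pvm_orth_projection[OF pvm] singleton_in_borel_words \<eta>)
    show "(\<lambda>k. norm ((x \<circ> r) k - y)) \<longlonglongrightarrow> 0"
      using lim by (simp add: tendsto_norm_zero_iff LIM_zero_iff comp_def)
  qed
  with lim_atoms have "(\<lambda>k. P {\<eta> k} (x (r k)) - P {\<eta> k} (x (r k) - y)) \<longlonglongrightarrow> y - 0"
    by (rule tendsto_diff)
  moreover have "P {\<eta> k} (x (r k)) - P {\<eta> k} (x (r k) - y) = P {\<eta> k} y" for k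
    using pvm_bounded_linear[OF pvm singleton_in_borel_words[OF \<eta>[of k]]] by (simp add: linear_simps)
  ultimately have lim_y: "(\<lambda>k. P {\<eta> k} y) \<longlonglongrightarrow> y"
    by simp
  have "\<not> inj \<eta>"
  proof
    assume "inj \<eta>"
    then have "(\<lambda>k. P {\<eta> k} y) \<longlonglongrightarrow> 0"
      using \<eta> by (rule pvm_distinct_atoms_tendsto_0[OF pvm])
    with lim_y have "y = 0"
      by (rule LIMSEQ_unique)
    with \<open>y \<noteq> 0\<close> show False
      by blast
  qed
  then obtain j k where "j \<noteq> k" and "\<eta> j = \<eta> k"
    by (auto simp: inj_def)
  moreover from this have "r j \<noteq> r k"
    using strict_mono_eq[OF r] by simp
  ultimately show periodic: "periodic_word \<omega>"
    unfolding periodic_word_def \<eta>_def by blast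
  \<comment> \<open>The convergent subsequence visits some point of the finite orbit infinitely often.\<close>
  have "finite (range \<eta>)"
    using finite_orbit_periodic_word[OF periodic] by (rule finite_subset[rotated]) (auto simp: \<eta>_def)
  then obtain k0 where "infinite {k. \<eta> k = \<eta> k0}"
    using pigeonhole_infinite[of UNIV \<eta>] by auto
  then have "\<exists>s. strict_mono (s :: nat \<Rightarrow> nat) \<and> (\<forall>i. s i \<in> {k. \<eta> k = \<eta> k0})"
    by (rule infinite_enumerate)
  then obtain s where s: "strict_mono (s :: nat \<Rightarrow> nat)" and const: "\<And>i. \<eta> (s i) = \<eta> k0"
    by auto
  have "(\<lambda>i. P {\<eta> (s i)} y) \<longlonglongrightarrow> y"
    using LIMSEQ_subseq_LIMSEQ[OF lim_y s] by (simp add: comp_def)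
  then have "P {\<eta> k0} y = y"
    by (simp add: const LIMSEQ_const_iff)
  moreover have "cyclic_word (\<eta> k0)"
  proof -
    have "r (s 0) < r (s 1)"
      using r s by (simp add: strict_mono_less)
    moreover have "(shift ^^ r (s 0)) \<omega> = (shift ^^ r (s 1)) \<omega>"
      using const by (simp flip: \<eta>_def)
    ultimately have "cyclic_word ((shift ^^ r (s 0)) \<omega>)"
      by (rule cyclic_word_shift_pow)
    then show ?thesis
      using const by (simp flip: \<eta>_def)
  qed
  ultimately show "\<exists>\<omega>'\<in>words N. cyclic_word \<omega>' \<and> (\<exists>y\<in>M. y \<noteq> 0 \<and> P {\<omega>'} y = y)"
    using \<eta> \<open>y \<in> M\<close> \<open>y \<noteq> 0\<close> by blast
qed

end

theorem theorem4p18: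
  fixes N :: nat
    and S :: "nat \<Rightarrow> 'a::chilbert_space \<Rightarrow> 'a"
    and P :: "(nat \<Rightarrow> nat) set \<Rightarrow> 'a \<Rightarrow> 'a"
    and M :: "'a set"
  assumes "N \<ge> 2"
    and "cuntz_rep N S"
    and "associated_pvm N S P"
    and "purely_atomic N P"
    and "csubspace M"
    and "\<exists>B. finite B \<and> cspan B = M"
    and "M \<noteq> {0}"
    and "\<forall>i<N. cadjoint (S i) ` M \<subseteq> M"
  shows "(\<exists>\<omega>\<in>words N. cyclic_word \<omega> \<and> (\<exists>v. v \<noteq> 0 \<and> v \<in> range (P {\<omega>}) \<inter> M)) \<and>
    M \<subseteq> range (P {\<omega> \<in> pvm_support N P. periodic_word \<omega>})"
proof
  have compact: "compact (M \<inter> cball 0 K)" for K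
    using assms(6) compact_cspan_Int_cball by blast
  note periodic = periodic_if_atom_on_invariant_subspace[OF assms(2,3,8) compact]
  have pvm: "proj_valued_measure N P"
    using assms(3) by (simp add: associated_pvm_def)
  show "\<exists>\<omega>\<in>words N. cyclic_word \<omega> \<and> (\<exists>v. v \<noteq> 0 \<and> v \<in> range (P {\<omega>}) \<inter> M)"
  proof -
    have "0 \<in> M"
      using assms(5) by (rule complex_vector.subspace_0)
    with assms(7) obtain v where "v \<in> M" and "v \<noteq> 0"
      by blast
    \<comment> \<open>A vector without components at the atoms lies in the range of \<open>P {}\<close>.\<close>
    have "\<exists>\<omega>\<in>words N. P {\<omega>} v \<noteq> 0"
    proof (rule ccontr)
      assume "\<not> ?thesis"
      then have "v \<in> range (P {})"
        using assms(4) by (intro in_range_if_atoms_in[OF pvm]) (auto simp: borel_words_def)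
      with \<open>v \<noteq> 0\<close> show False
        using pvm_empty[OF pvm] by auto
    qed
    then obtain \<omega>' y where "\<omega>' \<in> words N" "cyclic_word \<omega>'" "y \<in> M" "y \<noteq> 0" "P {\<omega>'} y = y"
      using periodic(2)[OF \<open>v \<in> M\<close>] by blast
    then show ?thesis
      by (metis IntI rangeI)
  qed
  show "M \<subseteq> range (P {\<omega> \<in> pvm_support N P. periodic_word \<omega>})"
  proof
    fix v
    assume "v \<in> M"
    have "countable {\<omega> \<in> pvm_support N P. periodic_word \<omega>}"
      by (rule countable_subset[OF _ countable_periodic_words]) blast
    then have "{\<omega> \<in> pvm_support N P. periodic_word \<omega>} \<in> borel_words N"
      by (rule countable_in_borel_words) (auto simp: pvm_support_def)
    then show "v \<in> range (P {\<omega> \<in> pvm_support N P. periodic_word \<omega>})"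
    proof (rule in_range_if_atoms_in[OF pvm assms(4)])
      fix \<omega>
      assume \<omega>: "\<omega> \<in> words N" "P {\<omega>} v \<noteq> 0"
      then have "P {\<omega>} \<noteq> (\<lambda>x. 0)"
        by metis
      with \<omega> show "\<omega> \<in> {\<omega> \<in> pvm_support N P. periodic_word \<omega>}"
        using periodic(1)[OF \<open>v \<in> M\<close>] by (simp add: pvm_support_def)
    qed
  qed
qed

end
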